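(* The spiderweb $\mathcal{SW}_N$ is $\delta$-Gromov hyperbolic for some $\delta>0$.
   Context: $(N,d_N,\mu_N)$ is a geodesic doubling metric measure space. Dyadic system: fix constants $\eta>1$, $c_1,c_2>0$ and, for each $k\in\mathbb Z$, a partition $\mathscr D_k$ of $N$ into (measurable) sets called cubes at scale $k$ (cubes are regarded as labelled by their scale), such that for $\ell>k$ every $Q\in\mathscr D_k$ is contained in a unique $P\in\mathscr D_\ell$, denoted $Q^{(\ell-k)}$ (with $\widehat Q=Q^{(1)}$, $Q^{(0)}=Q$), and each $Q\in\mathscr D_k$ has a fixed center $c_Q$ with $B_N(c_Q,c_1\eta^k)\subset Q\subset B_N(c_Q,c_2\eta^k)$. Such systems exist by Christ's construction. The height of $Q\in\mathscr D_k$ is $\mathfrak h(Q)=k$. Graph $\mathcal{SW}_N$: fix $\lambda>\max\{\frac{\eta}{\eta-1}c_2,\,2c_2+1\}$ and for $Q\in\mathscr D_k$ put $\lambda Q=B_N(c_Q,\lambda\eta^k)$. The vertices of $\mathcal{SW}_N$ are $z_Q=(c_Q,\eta^k)$, $Q\in\mathscr D_k$, $k\in\mathbb Z$, with height $\mathfrak h(z_Q)=\mathfrak h(Q)=k$. Two distinct vertices $z_Q,z_R$ are joined by an edge iff either $R=\widehat Q$ or $Q=\widehat R$ (vertical edge), or $\mathfrak h(Q)=\mathfrak h(R)$, $Q\ne R$ and $\lambda Q\cap\lambda R\ne\emptyset$ (horizontal edge). This graph is connected; $d_{\mathcal{SW}_N}$ is its graph distance. $\mathcal{SW}_N$ is identified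 with the metric graph obtained by replacing every edge with a segment of length one. A geodesic metric space is $\delta$-Gromov hyperbolic if every geodesic triangle is $\delta$-slim, i.e. each side is contained in the $\delta$-neighbourhood of the union of the other two. *)

theory Defs
  imports "HOL-Analysis.Analysis"
begin

section \<open>Geodesic spaces and Gromov hyperbolicity\<close>

definition geodesic_segment ::
  "'p set \<Rightarrow> ('p \<Rightarrow> 'p \<Rightarrow> real) \<Rightarrow> 'p \<Rightarrow> 'p \<Rightarrow> 'p set \<Rightarrow> bool" where
  "geodesic_segment X d x y S \<longleftrightarrow>
     (\<exists>L \<gamma>. 0 \<le> L \<and> \<gamma> 0 = x \<and> \<gamma> L = y \<and> \<gamma> ` {0..L} = S \<and> S \<subseteq> X \<and>
            (\<forall>s\<in>{0..L}. \<forall>t\<in>{0..L}. d (\<gamma> s) (\<gamma> t) = \<bar>s - t\<bar>))"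

definition geodesic_space :: "'p set \<Rightarrow> ('p \<Rightarrow> 'p \<Rightarrow> real) \<Rightarrow> bool" where
  "geodesic_space X d \<longleftrightarrow>
     Metric_space X d \<and> (\<forall>x\<in>X. \<forall>y\<in>X. \<exists>S. geodesic_segment X d x y S)"

definition neighbourhood ::
  "'p set \<Rightarrow> ('p \<Rightarrow> 'p \<Rightarrow> real) \<Rightarrow> real \<Rightarrow> 'p set \<Rightarrow> 'p set" where
  "neighbourhood X d \<delta> A = {p \<in> X. \<exists>q\<in>A. d p q < \<delta>}"

definition gromov_hyperbolic :: "real \<Rightarrow> 'p set \<Rightarrow> ('p \<Rightarrow> 'p \<Rightarrow> real) \<Rightarrow> bool" where
  "gromov_hyperbolic \<delta> X d \<longleftrightarrow>
     geodesic_space X d \<and>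
     (\<forall>x\<in>X. \<forall>y\<in>X. \<forall>z\<in>X. \<forall>A B C.
        geodesic_segment X d x y A \<longrightarrow>
        geodesic_segment X d y z B \<longrightarrow>
        geodesic_segment X d z x C \<longrightarrow>
          A \<subseteq> neighbourhood X d \<delta> (B \<union> C) \<and>
          B \<subseteq> neighbourhood X d \<delta> (C \<union> A) \<and>
          C \<subseteq> neighbourhood X d \<delta> (A \<union> B))"


section \<open>The metric graph of a simple graph\<close>

text \<open>
  A graph is a vertex set together with an irreflexive symmetric adjacency relation.
  Points of its metric graph are given by their barycentric coordinates, so that
  \<open>edge_point u v t\<close> is the point at distance \<open>t\<close> from \<open>u\<close> on the unit segment from
  \<open>u\<close> to \<open>v\<close>, that is, \<open>edge_point u v t = edge_point v u (1 - t)\<close>; the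
  function \<open>edge_point u u 0\<close> is the vertex \<open>u\<close> itself.
\<close>

definition edge_point :: "'v \<Rightarrow> 'v \<Rightarrow> real \<Rightarrow> ('v \<Rightarrow> real)" where
  "edge_point u v t = (\<lambda>w. (1 - t) * of_bool (w = u) + t * of_bool (w = v))"

definition metric_graph :: "'v set \<Rightarrow> ('v \<Rightarrow> 'v \<Rightarrow> bool) \<Rightarrow> ('v \<Rightarrow> real) set" where
  "metric_graph V adj =
     {edge_point u u 0 | u. u \<in> V} \<union>
     {edge_point u v t | u v t. u \<in> V \<and> v \<in> V \<and> adj u v \<and> t \<in> {0..1}}"

text \<open>
  \<open>pl_path V adj p q l\<close>: there is a piecewise linear path of length \<open>l\<close> from \<open>p\<close> to \<open>q\<close>,
  each piece of which runs inside one closed edge.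
\<close>

inductive pl_path ::
  "'v set \<Rightarrow> ('v \<Rightarrow> 'v \<Rightarrow> bool) \<Rightarrow> ('v \<Rightarrow> real) \<Rightarrow> ('v \<Rightarrow> real) \<Rightarrow> real \<Rightarrow> bool"
  for V adj p where
  start: "p \<in> metric_graph V adj \<Longrightarrow> pl_path V adj p p 0"
| step: "pl_path V adj p (edge_point u v s) l \<Longrightarrow>
         u \<in> V \<Longrightarrow> v \<in> V \<Longrightarrow> adj u v \<Longrightarrow> s \<in> {0..1} \<Longrightarrow> t \<in> {0..1} \<Longrightarrow>
         pl_path V adj p (edge_point u v t) (l + \<bar>s - t\<bar>)"

text \<open>
  The path metric. The value \<open>0\<close> for points not joined by any path is a dummy: it makes
  the function nonnegative and symmetric on the whole type, as \<^locale>\<open>Metric_space\<close>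
  demands, and if two distinct points of the metric graph are not joined by a path,
  then the function is not a metric there.
\<close>

definition metric_graph_dist ::
  "'v set \<Rightarrow> ('v \<Rightarrow> 'v \<Rightarrow> bool) \<Rightarrow> ('v \<Rightarrow> real) \<Rightarrow> ('v \<Rightarrow> real) \<Rightarrow> real" where
  "metric_graph_dist V adj p q =
     (if \<exists>l. pl_path V adj p q l then Inf {l. pl_path V adj p q l} else 0)"


section \<open>Doubling measures and dyadic systems\<close>

text \<open>
  The \<open>\<sigma>\<close>-algebra only has to contain the Borel sets, so that completed Borel measures
  are allowed.
\<close>

definition doubling_measure :: "'a::metric_space measure \<Rightarrow> bool" where
  "doubling_measure \<mu> \<longleftrightarrow>
     sets borel \<subseteq> sets \<mu> \<and>
     (\<forall>x r. 0 < r \<longrightarrow> 0 < emeasure \<mu> (ball x r) \<and> emeasure \<mu> (ball x r) < \<infinity>) \<and>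
     (\<exists>C::real. \<forall>x r. 0 < r \<longrightarrow>
        emeasure \<mu> (ball x (2 * r)) \<le> ennreal C * emeasure \<mu> (ball x r))"

text \<open>
  The same set may be a cube at several scales, so a cube is a pair of a scale \<open>k\<close> and a
  set \<open>Q \<in> D k\<close>, and its center is \<open>c k Q\<close>.
\<close>

definition dyadic_system ::
  "'a::metric_space measure \<Rightarrow> real \<Rightarrow> real \<Rightarrow> real \<Rightarrow>
   (int \<Rightarrow> 'a set set) \<Rightarrow> (int \<Rightarrow> 'a set \<Rightarrow> 'a) \<Rightarrow> bool" where
  "dyadic_system \<mu> \<eta> c1 c2 D c \<longleftrightarrow>
     1 < \<eta> \<and> 0 < c1 \<and> 0 < c2 \<and>
     (\<forall>k. partition_on UNIV (D k)) \<and>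
     (\<forall>k. D k \<subseteq> sets \<mu>) \<and>
     (\<forall>k l. k < l \<longrightarrow> (\<forall>Q\<in>D k. \<exists>!P. P \<in> D l \<and> Q \<subseteq> P)) \<and>
     (\<forall>k. \<forall>Q\<in>D k. ball (c k Q) (c1 * \<eta> powi k) \<subseteq> Q \<and>
                    Q \<subseteq> ball (c k Q) (c2 * \<eta> powi k))"

definition parent :: "(int \<Rightarrow> 'a set set) \<Rightarrow> int \<Rightarrow> 'a set \<Rightarrow> 'a set" where
  "parent D k Q = (THE P. P \<in> D (k + 1) \<and> Q \<subseteq> P)"


section \<open>The spiderweb\<close>

definition sw_vertex ::
  "real \<Rightarrow> (int \<Rightarrow> 'a set \<Rightarrow> 'a) \<Rightarrow> int \<Rightarrow> 'a set \<Rightarrow> 'a \<times> real" where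
  "sw_vertex \<eta> c k Q = (c k Q, \<eta> powi k)"

definition sw_verts ::
  "real \<Rightarrow> (int \<Rightarrow> 'a set set) \<Rightarrow> (int \<Rightarrow> 'a set \<Rightarrow> 'a) \<Rightarrow> ('a \<times> real) set" where
  "sw_verts \<eta> D c = {sw_vertex \<eta> c k Q | k Q. Q \<in> D k}"

definition dilated_cube ::
  "real \<Rightarrow> real \<Rightarrow> (int \<Rightarrow> 'a set \<Rightarrow> 'a) \<Rightarrow> int \<Rightarrow> 'a set \<Rightarrow> 'a::metric_space set" where
  "dilated_cube lam \<eta> c k Q = ball (c k Q) (lam * \<eta> powi k)"

definition sw_adj ::
  "real \<Rightarrow> real \<Rightarrow> (int \<Rightarrow> 'a set set) \<Rightarrow> (int \<Rightarrow> 'a set \<Rightarrow> 'a) \<Rightarrow>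
   'a::metric_space \<times> real \<Rightarrow> 'a \<times> real \<Rightarrow> bool" where
  "sw_adj lam \<eta> D c z w \<longleftrightarrow>
     z \<noteq> w \<and>
     (\<exists>k Q l R. Q \<in> D k \<and> R \<in> D l \<and> z = sw_vertex \<eta> c k Q \<and> w = sw_vertex \<eta> c l R \<and>
        ((l = k + 1 \<and> R = parent D k Q) \<or>
         (k = l + 1 \<and> Q = parent D l R) \<or>
         (k = l \<and> Q \<noteq> R \<and> dilated_cube lam \<eta> c k Q \<inter> dilated_cube lam \<eta> c l R \<noteq> {})))"

definition spiderweb ::
  "real \<Rightarrow> real \<Rightarrow> (int \<Rightarrow> 'a set set) \<Rightarrow> (int \<Rightarrow> 'a set \<Rightarrow> 'a::metric_space) \<Rightarrow>
   ('a \<times> real \<Rightarrow> real) set" where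
  "spiderweb lam \<eta> D c = metric_graph (sw_verts \<eta> D c) (sw_adj lam \<eta> D c)"

definition spiderweb_dist ::
  "real \<Rightarrow> real \<Rightarrow> (int \<Rightarrow> 'a set set) \<Rightarrow> (int \<Rightarrow> 'a set \<Rightarrow> 'a::metric_space) \<Rightarrow>
   ('a \<times> real \<Rightarrow> real) \<Rightarrow> ('a \<times> real \<Rightarrow> real) \<Rightarrow> real" where
  "spiderweb_dist lam \<eta> D c = metric_graph_dist (sw_verts \<eta> D c) (sw_adj lam \<eta> D c)"

end

theory Submission
  imports Defs
begin

text \<open>
  For vertices \<open>z = (x, r)\<close> and \<open>w = (y, s)\<close> put \<open>A z w = dist x y + r + s\<close>. Up to an additive
  constant, their graph distance is \<open>2 log A z w - log r - log s\<close> (logarithms in base \<open>\<eta>\<close>). Indeed,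
  the ancestors at height about \<open>log A z w\<close> are neighbours; conversely, heights change by at most one
  along an edge, so a walk of length \<open>n\<close> that is split at its expected highest point consists of two
  pieces whose displacements are geometric sums bounded by a multiple of \<open>\<eta>\<close> to the power
  \<open>(n + log r + log s) / 2\<close>. Since \<open>A\<close> satisfies the triangle inequality,
  \<open>A x y * A z w \<le> 4 * max (A x z * A y w) (A x w * A y z)\<close>, and taking logarithms gives Gromov's
  four-point inequality, which survives additive errors and implies slim triangles in a geodesic space.
\<close>

section \<open>Slim triangles from the four-point inequality\<close>

text \<open>The function \<open>d\<close> is arbitrary because the condition is also applied to
  \<open>\<rho>\<close>, which is positive on the diagonal and hence no metric.\<close>

definition four_point :: "real \<Rightarrow> 'p set \<Rightarrow> ('p \<Rightarrow> 'p \<Rightarrow> real) \<Rightarrow> bool" where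
  "four_point \<kappa> X d \<longleftrightarrow>
     (\<forall>x\<in>X. \<forall>y\<in>X. \<forall>z\<in>X. \<forall>w\<in>X.
        d x y + d z w \<le> max (d x z + d y w) (d x w + d y z) + \<kappa>)"

section \<open>Points on geodesic segments\<close>

lemma geodesic_segment_commute:
  assumes "geodesic_segment X d x y S"
  shows "geodesic_segment X d y x S"
proof -
  obtain L \<gamma> where L: "0 \<le> L" "\<gamma> 0 = x" "\<gamma> L = y" "\<gamma> ` {0..L} = S" "S \<subseteq> X"
    and iso: "\<forall>s\<in>{0..L}. \<forall>t\<in>{0..L}. d (\<gamma> s) (\<gamma> t) = \<bar>s - t\<bar>"
    using assms unfolding geodesic_segment_def by blast
  have "(\<lambda>t. L - t) ` {0..L} = {0..L}"
    using image_diff_atLeastAtMost[of L 0 L] by simp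
  then have "(\<lambda>t. \<gamma> (L - t)) ` {0..L} = S"
    using L(4) by (metis image_image)
  moreover have "\<forall>s\<in>{0..L}. \<forall>t\<in>{0..L}. d (\<gamma> (L - s)) (\<gamma> (L - t)) = \<bar>s - t\<bar>"
    using iso by auto
  ultimately show ?thesis
    unfolding geodesic_segment_def using L
    by (intro exI[of _ L] exI[of _ "\<lambda>t. \<gamma> (L - t)"]) auto
qed

lemma geodesic_segment_point:
  assumes "geodesic_segment X d x y S" "0 \<le> r" "r \<le> d x y"
  obtains q where "q \<in> S" "d x q = r" "d q y = d x y - r"
proof -
  obtain L \<gamma> where L: "0 \<le> L" "\<gamma> 0 = x" "\<gamma> L = y" "\<gamma> ` {0..L} = S"
    and iso: "\<forall>s\<in>{0..L}. \<forall>t\<in>{0..L}. d (\<gamma> s) (\<gamma> t) = \<bar>s - t\<bar>"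
    using assms(1) unfolding geodesic_segment_def by blast
  have dL: "d x y = L" using iso L by force
  have "\<gamma> r \<in> S" "d x (\<gamma> r) = r" "d (\<gamma> r) y = L - r"
    using iso[rule_format, of 0 r] iso[rule_format, of r L] L assms dL by auto
  then show ?thesis using that dL by blast
qed

lemma geodesic_segment_between:
  assumes "geodesic_segment X d x y S" "p \<in> S"
  shows "d x p + d p y = d x y" "0 \<le> d x p" "0 \<le> d p y"
proof -
  obtain L \<gamma> where L: "0 \<le> L" "\<gamma> 0 = x" "\<gamma> L = y" "\<gamma> ` {0..L} = S"
    and iso: "\<forall>s\<in>{0..L}. \<forall>t\<in>{0..L}. d (\<gamma> s) (\<gamma> t) = \<bar>s - t\<bar>"
    using assms(1) unfolding geodesic_segment_def by blast
  obtain t where t: "t \<in> {0..L}" "p = \<gamma> t" using L(4) assms(2) by auto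
  have "d x p = t" "d p y = L - t" "d x y = L"
    using iso[rule_format, of 0 t] iso[rule_format, of t L] iso[rule_format, of 0 L] L t by auto
  then show "d x p + d p y = d x y" "0 \<le> d x p" "0 \<le> d p y" using t by auto
qed

lemma geodesic_segment_subset: "geodesic_segment X d x y S \<Longrightarrow> S \<subseteq> X"
  unfolding geodesic_segment_def by blast

text \<open>Compare \<open>p\<close> with the point \<open>q\<close> of \<open>C\<close> at the same
  distance from \<open>x\<close>: in the four-point inequality for the pairs \<open>p q\<close> and
  \<open>x z\<close>, both alternatives are then at most \<open>d x z + \<kappa>\<close> before the
  error \<open>\<kappa>\<close> is added.\<close>

lemma near_geodesic:
  assumes M: "Metric_space X d" and fp: "four_point \<kappa> X d"
    and C: "geodesic_segment X d x z C"
    and X: "x \<in> X" "z \<in> X" "p \<in> X"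
    and near: "d x p + d z p \<le> d x z + \<kappa>"
  shows "\<exists>q\<in>C. d p q \<le> 2 * \<kappa>"
proof -
  interpret Metric_space X d by fact
  have pos: "0 \<le> \<kappa>"
    using near triangle[of x p z] X commute[of z p] by simp
  \<comment> \<open>The minimum covers a point \<open>p\<close> that is farther from
    \<open>x\<close> than \<open>z\<close> is: then \<open>q = z\<close>, and \<open>near\<close>
    alone gives the bound.\<close>
  obtain q where q: "q \<in> C" "d x q = min (d x p) (d x z)" "d q z = d x z - min (d x p) (d x z)"
    using geodesic_segment_point[OF C, of "min (d x p) (d x z)"] nonneg by auto
  have qX: "q \<in> X" using q(1) geodesic_segment_subset[OF C] by blast
  have "d p q + d x z \<le> max (d p x + d q z) (d p z + d q x) + \<kappa>"
    using fp X qX unfolding four_point_def by blast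
  moreover have "d p q \<le> 2 * \<kappa>" if "d x z < d x p"
  proof -
    have "q = z" using q that qX X by simp
    then show ?thesis using near that commute[of z p] pos by simp
  qed
  ultimately have "d p q \<le> 2 * \<kappa>"
    using q near pos commute[of p x] commute[of p z] commute[of q x]
    by (cases "d x z < d x p") (auto simp: min_def max_def split: if_splits)
  then show ?thesis using q(1) by blast
qed

text \<open>Since \<open>d x y = d x p + d p y\<close>, the inequality for the pairs
  \<open>x y\<close> and \<open>z p\<close> says that \<open>p\<close> lies almost between
  \<open>x\<close> and \<open>z\<close> or almost between \<open>y\<close> and \<open>z\<close>, so
  it is near \<open>C\<close> or near \<open>B\<close>.\<close>

lemma four_point_slim:
  assumes M: "Metric_space X d" and fp: "four_point \<kappa> X d"
    and X: "x \<in> X" "y \<in> X" "z \<in> X"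
    and A: "geodesic_segment X d x y A"
    and B: "geodesic_segment X d y z B"
    and C: "geodesic_segment X d z x C"
    and \<delta>: "2 * \<kappa> < \<delta>"
  shows "A \<subseteq> neighbourhood X d \<delta> (B \<union> C)"
proof
  interpret Metric_space X d by fact
  fix p assume p: "p \<in> A"
  have pX: "p \<in> X" using p geodesic_segment_subset[OF A] by blast
  note btw = geodesic_segment_between[OF A p]
  have "d x y + d z p \<le> max (d x z + d y p) (d x p + d y z) + \<kappa>"
    using fp X pX unfolding four_point_def by blast
  then consider "d x p + d z p \<le> d x z + \<kappa>" | "d y p + d z p \<le> d y z + \<kappa>"
    using btw commute[of p y] by (auto simp: max_def split: if_splits)
  then have "\<exists>q\<in>B \<union> C. d p q < \<delta>"
  proof cases
    case 1
    then show ?thesis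
      using near_geodesic[OF M fp geodesic_segment_commute[OF C] X(1,3) pX] \<delta> by (meson UnCI order_le_less_trans)
  next
    case 2
    then show ?thesis
      using near_geodesic[OF M fp B X(2,3) pX] \<delta> by (meson UnCI order_le_less_trans)
  qed
  then show "p \<in> neighbourhood X d \<delta> (B \<union> C)"
    using pX unfolding neighbourhood_def by blast
qed

lemma four_point_hyperbolic:
  assumes "geodesic_space X d" "four_point \<kappa> X d" "2 * \<kappa> < \<delta>"
  shows "gromov_hyperbolic \<delta> X d"
proof -
  have "Metric_space X d" using assms(1) unfolding geodesic_space_def by blast
  note slim = four_point_slim[OF this assms(2) _ _ _ _ _ _ assms(3)]
  show ?thesis
    unfolding gromov_hyperbolic_def
    using assms(1) slim by (intro conjI ballI allI impI) (assumption | blast)+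
qed

text \<open>The smallest of the four cross distances bounds one factor on each side through the
  triangle inequality.\<close>

lemma product_four_point:
  fixes a b c d e f :: real
  assumes "0 \<le> c" "0 \<le> d" "0 \<le> e" "0 \<le> f" "0 \<le> a" "0 \<le> b"
    and "a \<le> c + f" "a \<le> e + d" "b \<le> c + e" "b \<le> d + f"
  shows "a * b \<le> 4 * max (c * d) (e * f)"
proof -
  have *: "a * b \<le> 4 * (u * v)" if "a \<le> 2 * u" "b \<le> 2 * v" "0 \<le> u" for u v
    using mult_mono[OF that(1,2)] that(3) assms by simp
  consider "c \<le> d \<and> c \<le> e \<and> c \<le> f" | "d \<le> c \<and> d \<le> e \<and> d \<le> f"
    | "e \<le> d \<and> e \<le> c \<and> e \<le> f" | "f \<le> d \<and> f \<le> e \<and> f \<le> c" by argo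
  then show ?thesis
  proof cases
    case 1 then show ?thesis using *[of f e] assms by (auto simp: mult.commute max_def)
  next
    case 2 then show ?thesis using *[of e f] assms by (auto simp: mult.commute max_def)
  next
    case 3 then show ?thesis using *[of d c] assms by (auto simp: mult.commute max_def)
  next
    case 4 then show ?thesis using *[of c d] assms by (auto simp: mult.commute max_def)
  qed
qed

section \<open>Metric graphs\<close>

text \<open>Taken as a relation, so that its power \<open>^^ n\<close> relates the ends of walks
  with \<open>n\<close> edges.\<close>

definition graph_edges :: "'v set \<Rightarrow> ('v \<Rightarrow> 'v \<Rightarrow> bool) \<Rightarrow> ('v \<times> 'v) set" where
  "graph_edges V adj = {(u, v). u \<in> V \<and> v \<in> V \<and> adj u v}"

abbreviation vertex_point :: "'v \<Rightarrow> 'v \<Rightarrow> real" where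
  "vertex_point u \<equiv> edge_point u u 0"

lemma edge_point_flip: "edge_point u v t = edge_point v u (1 - t)"
  unfolding edge_point_def by auto

lemma edge_point_0: "edge_point u v 0 = vertex_point u"
  unfolding edge_point_def by auto

lemma edge_point_1: "edge_point u v 1 = vertex_point v"
  unfolding edge_point_def by auto

text \<open>The case \<open>u = v\<close> has to be excluded because \<open>edge_point u u t\<close>
  is \<open>vertex_point u\<close> for every \<open>t\<close>.\<close>

lemma edge_point_eq_vertex_point:
  assumes "edge_point u v t = vertex_point w" "u \<noteq> v"
  shows "t = 0 \<and> u = w \<or> t = 1 \<and> v = w"
  using fun_cong[OF assms(1), of u] fun_cong[OF assms(1), of v] assms(2)
  unfolding edge_point_def by (auto split: if_splits simp: of_bool_def)

text \<open>The support of an interior point consists of the two ends of its edge, which fixes the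
  edge up to orientation.\<close>

lemma edge_point_eq_interior:
  assumes "edge_point u v s = edge_point u' v' s'" "u \<noteq> v" "u' \<noteq> v'" "0 < s" "s < 1"
  shows "u' = u \<and> v' = v \<and> s' = s \<or> u' = v \<and> v' = u \<and> s' = 1 - s"
proof -
  note e = fun_cong[OF assms(1), unfolded edge_point_def]
  show ?thesis using e[of u] e[of v] e[of u'] e[of v'] assms(2-5)
    by (auto split: if_splits simp: of_bool_def)
qed

locale simple_graph =
  fixes V :: "'v set" and adj :: "'v \<Rightarrow> 'v \<Rightarrow> bool"
  assumes adj_sym: "adj u v \<Longrightarrow> adj v u"
    and adj_irrefl: "\<not> adj u u"
begin

abbreviation "E \<equiv> graph_edges V adj"
abbreviation "X \<equiv> metric_graph V adj"
abbreviation "gpath \<equiv> pl_path V adj"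
abbreviation "d \<equiv> metric_graph_dist V adj"

lemma E_sym: "(u, v) \<in> E \<Longrightarrow> (v, u) \<in> E"
  using adj_sym unfolding graph_edges_def by auto

lemma E_neq: "(u, v) \<in> E \<Longrightarrow> u \<noteq> v"
  using adj_irrefl unfolding graph_edges_def by auto

lemma E_verts: "(u, v) \<in> E \<Longrightarrow> u \<in> V" "(u, v) \<in> E \<Longrightarrow> v \<in> V"
  unfolding graph_edges_def by auto

lemma vertex_point_in: "u \<in> V \<Longrightarrow> vertex_point u \<in> X"
  unfolding metric_graph_def by blast

lemma edge_point_in: "(u, v) \<in> E \<Longrightarrow> t \<in> {0..1} \<Longrightarrow> edge_point u v t \<in> X"
  unfolding metric_graph_def graph_edges_def by blast

lemma metric_graph_cases [consumes 1, case_names vertex edge]: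
  assumes "p \<in> X"
  obtains u where "u \<in> V" "p = vertex_point u"
  | u v t where "(u, v) \<in> E" "0 \<le> t" "t \<le> 1" "p = edge_point u v t"
  using assms unfolding metric_graph_def graph_edges_def by auto

section \<open>Piecewise linear paths and walks\<close>

lemma path_step:
  "gpath p (edge_point u v s) l \<Longrightarrow> (u, v) \<in> E \<Longrightarrow> s \<in> {0..1} \<Longrightarrow> t \<in> {0..1} \<Longrightarrow>
     gpath p (edge_point u v t) (l + \<bar>s - t\<bar>)"
  using pl_path.step unfolding graph_edges_def by fastforce

lemma path_induct [consumes 1, case_names start step]:
  assumes "gpath p q l"
    and "p \<in> X \<Longrightarrow> P p 0"
    and "\<And>u v s t l. gpath p (edge_point u v s) l \<Longrightarrow> P (edge_point u v s) l \<Longrightarrow> (u, v) \<in> E \<Longrightarrow>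
           0 \<le> s \<Longrightarrow> s \<le> 1 \<Longrightarrow> 0 \<le> t \<Longrightarrow> t \<le> 1 \<Longrightarrow> P (edge_point u v t) (l + \<bar>s - t\<bar>)"
  shows "P q l"
  using assms(1)
proof induction
  case start
  then show ?case using assms(2) by blast
next
  case (step u v s l t)
  then show ?case using assms(3)[of u v s l t] unfolding graph_edges_def by auto
qed

lemma path_nonneg: "gpath p q l \<Longrightarrow> 0 \<le> l"
  by (induction rule: path_induct) auto

lemma path_in: "gpath p q l \<Longrightarrow> p \<in> X" "gpath p q l \<Longrightarrow> q \<in> X"
proof -
  show "p \<in> X" if "gpath p q l" using that by (induction rule: path_induct) auto
  show "q \<in> X" if "gpath p q l" using that by (induction rule: path_induct) (auto intro: edge_point_in)
qed

lemma path_edge: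
  "(u, v) \<in> E \<Longrightarrow> s \<in> {0..1} \<Longrightarrow> t \<in> {0..1} \<Longrightarrow> gpath (edge_point u v s) (edge_point u v t) \<bar>s - t\<bar>"
  using path_step[OF pl_path.start[OF edge_point_in], of u v s t] by simp

lemma path_trans: "gpath q r m \<Longrightarrow> gpath p q l \<Longrightarrow> gpath p r (l + m)"
proof (induction rule: path_induct)
  case start
  then show ?case by simp
next
  case (step u v s t m)
  then show ?case using path_step[of p u v s "l + m" t] by (simp add: add.assoc)
qed

lemma path_sym: "gpath p q l \<Longrightarrow> gpath q p l"
proof (induction rule: path_induct)
  case start
  then show ?case by (rule pl_path.start)
next
  case (step u v s t l)
  then show ?case using path_trans[OF step.IH path_edge[of u v t s]] step.hyps
    by (simp add: add.commute abs_minus_commute)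
qed

text \<open>This separates points: if paths of length zero join \<open>p\<close> to
  \<open>q\<close>, all barycentric coordinates agree.\<close>

lemma path_coordinate: "gpath p q l \<Longrightarrow> \<bar>p w - q w\<bar> \<le> l"
proof (induction rule: path_induct)
  case start
  then show ?case by simp
next
  case (step u v s t l)
  have "\<bar>edge_point u v s w - edge_point u v t w\<bar> \<le> \<bar>s - t\<bar>"
    using E_neq[OF step.hyps(2)] by (auto simp: edge_point_def of_bool_def)
  then show ?case using step by linarith
qed

lemma path_walk: "(u, v) \<in> E ^^ n \<Longrightarrow> u \<in> V \<Longrightarrow> gpath (vertex_point u) (vertex_point v) (real n)"
proof (induction n arbitrary: v)
  case 0
  then show ?case using pl_path.start[OF vertex_point_in] by simp
next
  case (Suc n)
  then obtain w where w: "(u, w) \<in> E ^^ n" "(w, v) \<in> E" by auto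
  then have "gpath (vertex_point u) (edge_point w v 0) (real n)"
    using Suc edge_point_0[of w v] by simp
  from path_step[OF this w(2), of 1] show ?case
    by (simp add: edge_point_1 add.commute)
qed

lemma walk_sym: "(u, v) \<in> E ^^ n \<Longrightarrow> (v, u) \<in> E ^^ n"
proof (induction n arbitrary: v)
  case (Suc n)
  then obtain w where "(u, w) \<in> E ^^ n" "(w, v) \<in> E" by auto
  then show ?case using Suc.IH E_sym relpow_Suc_I2 by fast
qed simp

lemma walk_verts: "(u, v) \<in> E ^^ n \<Longrightarrow> u \<in> V \<Longrightarrow> v \<in> V"
  using E_verts(2) by (cases n) auto

text \<open>The affine extension of \<open>f\<close> along the edges inherits its Lipschitz constant.\<close>

lemma path_vertex_lipschitz:
  assumes f: "\<And>u v. (u, v) \<in> E \<Longrightarrow> \<bar>f u - f v\<bar> \<le> (1::real)"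
    and path: "gpath (vertex_point a) (vertex_point b) l"
  shows "\<bar>f a - f b\<bar> \<le> l"
proof -
  \<comment> \<open>Weighting \<open>f\<close> by barycentric coordinates over the support gives a
    value that does not depend on the edge chosen to represent a point.\<close>
  define \<phi> where "\<phi> q = (\<Sum>w | q w \<noteq> (0::real). q w * f w)" for q
  have \<phi>_edge: "\<phi> (edge_point u v t) = (1 - t) * f u + t * f v" if "u \<noteq> v" for u v t
  proof -
    have "\<phi> (edge_point u v t) = (\<Sum>w\<in>{u, v}. edge_point u v t w * f w)"
      unfolding \<phi>_def by (rule sum.mono_neutral_left) (auto simp: edge_point_def)
    then show ?thesis using that by (simp add: edge_point_def)
  qed
  have \<phi>_vertex: "\<phi> (vertex_point u) = f u" for u
  proof -
    have "\<phi> (vertex_point u) = (\<Sum>w\<in>{u}. vertex_point u w * f w)"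
      unfolding \<phi>_def by (rule sum.mono_neutral_left) (auto simp: edge_point_def)
    then show ?thesis by (simp add: edge_point_def)
  qed
  have "\<bar>\<phi> p - \<phi> q\<bar> \<le> l" if "gpath p q l" for p q
    using that
  proof (induction rule: path_induct)
    case start
    then show ?case by simp
  next
    case (step u v s t l)
    have "\<phi> (edge_point u v s) - \<phi> (edge_point u v t) = (s - t) * (f v - f u)"
      using \<phi>_edge[OF E_neq[OF step.hyps(2)]] by (simp add: algebra_simps)
    then have "\<bar>\<phi> (edge_point u v s) - \<phi> (edge_point u v t)\<bar> \<le> \<bar>s - t\<bar>"
      using mult_left_mono[OF f[OF E_sym[OF step.hyps(2)]], of "\<bar>s - t\<bar>"] by (simp add: abs_mult)
    then show ?case using step by linarith
  qed
  from this[OF path] show ?thesis by (simp add: \<phi>_vertex)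
qed

text \<open>The number \<open>f v\<close> of edges in a shortest walk from \<open>a\<close> to
  \<open>v\<close> changes by at most one along an edge and vanishes at \<open>a\<close>. By the
  Lipschitz bound, \<open>f b\<close> is at most \<open>l\<close>.\<close>

lemma walk_of_path:
  assumes conn: "\<And>u v. u \<in> V \<Longrightarrow> v \<in> V \<Longrightarrow> \<exists>n. (u, v) \<in> E ^^ n"
    and "a \<in> V" "b \<in> V" and path: "gpath (vertex_point a) (vertex_point b) l"
  obtains n where "(a, b) \<in> E ^^ n" "real n \<le> l"
proof -
  define f where "f v = (LEAST n. (a, v) \<in> E ^^ n)" for v
  have walk: "(a, v) \<in> E ^^ f v" if "v \<in> V" for v
    unfolding f_def by (rule LeastI_ex) (rule conn[OF assms(2) that])
  have least: "f v \<le> n" if "(a, v) \<in> E ^^ n" for v n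
    unfolding f_def by (rule Least_le) (rule that)
  have step: "f v \<le> f u + 1" if "(u, v) \<in> E" for u v
    using least[of v "Suc (f u)"] walk[of u] E_verts[OF that] that by auto
  have "\<bar>real (f u) - real (f v)\<bar> \<le> 1" if "(u, v) \<in> E" for u v
    using step[OF that] step[OF E_sym[OF that]] by linarith
  from path_vertex_lipschitz[of "\<lambda>v. real (f v)", OF this path] have "real (f b) - real (f a) \<le> l" by linarith
  moreover have "f a = 0" using least[of a 0] by simp
  ultimately show ?thesis using that[OF walk[OF assms(3)]] by simp
qed

text \<open>Walks from \<open>p\<close> to a vertex that first run straight to an end of the edge of \<open>p\<close> and then
  along whole edges.\<close>

definition reduced_to :: "('v \<Rightarrow> real) \<Rightarrow> 'v \<Rightarrow> real \<Rightarrow> bool" where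
  "reduced_to p b m \<longleftrightarrow> gpath p (vertex_point b) m \<and> (\<exists>a n. m = 1 - p a + real n)"

lemma reduced_to_step:
  assumes "reduced_to p b m" "(b, b') \<in> E"
  shows "reduced_to p b' (m + 1)"
proof -
  obtain a n where "gpath p (vertex_point b) m" and m: "m = 1 - p a + real n"
    using assms(1) unfolding reduced_to_def by blast
  then have "gpath p (vertex_point b') (m + 1)"
    using path_step[of p b b' 0 m 1] assms(2) edge_point_0[of b b'] edge_point_1[of b b'] by simp
  moreover have "m + 1 = 1 - p a + real (Suc n)" using m by simp
  ultimately show ?thesis unfolding reduced_to_def by blast
qed

text \<open>Three normal forms, none longer than the given path: a segment inside one edge, a
  reduced walk ending at a vertex, and such a walk followed by a piece of length
  \<open>\<tau>\<close> into an edge. Each new piece preserves this list.\<close>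

lemma path_reduce:
  assumes "gpath p q l"
  shows "(\<exists>u v s t. (u, v) \<in> E \<and> s \<in> {0..1} \<and> t \<in> {0..1} \<and>
            p = edge_point u v s \<and> q = edge_point u v t \<and> \<bar>s - t\<bar> \<le> l) \<or>
         (\<exists>b m. reduced_to p b m \<and> q = vertex_point b \<and> m \<le> l) \<or>
         (\<exists>b b' \<tau> m. reduced_to p b m \<and> (b, b') \<in> E \<and> \<tau> \<in> {0..1} \<and>
            q = edge_point b b' \<tau> \<and> m + \<tau> \<le> l)"
    (is "?A q l \<or> ?B q l \<or> ?C q l")
  using assms
proof (induction rule: path_induct)
  case start
  then show ?case
  proof (cases rule: metric_graph_cases)
    case (vertex u)
    then have "reduced_to p u 0"
      using pl_path.start[OF start]
      unfolding reduced_to_def by (auto intro!: exI[of _ u] exI[of _ 0] simp: edge_point_def)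
    then show ?thesis using vertex by auto
  next
    case (edge u v t)
    then have "?A p 0" by (intro exI[of _ u] exI[of _ v] exI[of _ t]) auto
    then show ?thesis ..
  qed
next
  case (step u v s t l)
  \<comment> \<open>At a vertex the next piece may enter any edge, so whichever form arrives there
    is first turned into a reduced walk to that vertex.\<close>
  have from_vertex: "\<exists>m\<le>l. reduced_to p w m" if q: "edge_point u v s = vertex_point w" for w
  proof -
    consider "?A (vertex_point w) l" | "?B (vertex_point w) l" | "?C (vertex_point w) l"
      using step.IH unfolding q by blast
    then show ?thesis
    proof cases
      case 1
      then obtain u' v' s' t' where uv: "(u', v') \<in> E" "s' \<in> {0..1}" "t' \<in> {0..1}"
        "p = edge_point u' v' s'" "vertex_point w = edge_point u' v' t'" "\<bar>s' - t'\<bar> \<le> l"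
        by blast
      have "gpath p (vertex_point w) \<bar>s' - t'\<bar>" using path_edge[OF uv(1-3)] uv by simp
      moreover have "t' = 0 \<or> t' = 1"
        using edge_point_eq_vertex_point[OF uv(5)[symmetric] E_neq[OF uv(1)]] by blast
      \<comment> \<open>The distance from \<open>p\<close> to an end \<open>a\<close> of its edge is
        \<open>1 - p a\<close>.\<close>
      then have "\<exists>a. \<bar>s' - t'\<bar> = 1 - p a"
      proof
        assume "t' = 0" then show ?thesis using uv E_neq[OF uv(1)]
          by (intro exI[of _ u']) (auto simp: edge_point_def)
      next
        assume "t' = 1" then show ?thesis using uv E_neq[OF uv(1)]
          by (intro exI[of _ v']) (auto simp: edge_point_def)
      qed
      then have "\<exists>a n. \<bar>s' - t'\<bar> = 1 - p a + real n" by (metis add.right_neutral of_nat_0)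
      ultimately have "reduced_to p w \<bar>s' - t'\<bar>" unfolding reduced_to_def by blast
      then show ?thesis using uv(6) by blast
    next
      case 2
      then obtain b m where "reduced_to p b m" "vertex_point w = vertex_point b" "m \<le> l" by blast
      moreover from fun_cong[OF this(2), of w] have "w = b"
        by (auto simp: edge_point_def split: if_splits)
      ultimately show ?thesis by auto
    next
      case 3
      then obtain b b' \<tau> m where b: "reduced_to p b m" "(b, b') \<in> E" "\<tau> \<in> {0..1}"
        "vertex_point w = edge_point b b' \<tau>" "m + \<tau> \<le> l" by blast
      from edge_point_eq_vertex_point[OF b(4)[symmetric] E_neq[OF b(2)]] show ?thesis
      proof
        assume "\<tau> = 0 \<and> b = w" then show ?thesis using b by auto
      next
        assume "\<tau> = 1 \<and> b' = w" then show ?thesis using reduced_to_step[OF b(1,2)] b(5) by auto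
      qed
    qed
  qed
  consider "s = 0" | "s = 1" | "0 < s \<and> s < 1" using step.hyps by linarith
  then show ?case
  proof cases
    case 1
    then obtain m where "m \<le> l" "reduced_to p u m" using from_vertex edge_point_0 by metis
    then have "?C (edge_point u v t) (l + \<bar>s - t\<bar>)"
      using step.hyps 1 by (intro exI[of _ u] exI[of _ v] exI[of _ t] exI[of _ m]) auto
    then show ?thesis by blast
  next
    case 2
    then obtain m where "m \<le> l" "reduced_to p v m" using from_vertex edge_point_1 by metis
    then have "?C (edge_point u v t) (l + \<bar>s - t\<bar>)"
      using step.hyps 2 E_sym edge_point_flip[of u v t]
      by (intro exI[of _ v] exI[of _ u] exI[of _ "1 - t"] exI[of _ m]) auto
    then show ?thesis by blast
  next
    case 3
    \<comment> \<open>An interior point determines its edge, so the new piece stays in the edge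
      already reached and only the final parameter changes; the triangle inequality bounds the
      length.\<close>
    note same = edge_point_eq_interior[OF _ E_neq[OF step.hyps(2)] E_neq]
    consider "?A (edge_point u v s) l" | "?B (edge_point u v s) l" | "?C (edge_point u v s) l"
      using step.IH by blast
    then show ?thesis
    proof cases
      case A: 1
      then obtain u' v' s' t' where uv: "(u', v') \<in> E" "s' \<in> {0..1}" "t' \<in> {0..1}"
        "p = edge_point u' v' s'" "edge_point u v s = edge_point u' v' t'" "\<bar>s' - t'\<bar> \<le> l"
        by blast
      from same[OF uv(5,1)] 3 consider "u' = u" "v' = v" "t' = s" | "u' = v" "v' = u" "t' = 1 - s"
        by blast
      then have "?A (edge_point u v t) (l + \<bar>s - t\<bar>)"
      proof cases
        case 1
        then show ?thesis using uv step.hyps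
          by (intro exI[of _ u] exI[of _ v] exI[of _ s'] exI[of _ t]) auto
      next
        case 2
        then show ?thesis using uv step.hyps edge_point_flip[of u v t]
          by (intro exI[of _ v] exI[of _ u] exI[of _ s'] exI[of _ "1 - t"]) auto
      qed
      then show ?thesis by blast
    next
      case B: 2
      then obtain b where "edge_point u v s = vertex_point b" by blast
      from edge_point_eq_vertex_point[OF this E_neq[OF step.hyps(2)]] show ?thesis using 3 by simp
    next
      case C: 3
      then obtain b b' \<tau> m where b: "reduced_to p b m" "(b, b') \<in> E" "\<tau> \<in> {0..1}"
        "edge_point u v s = edge_point b b' \<tau>" "m + \<tau> \<le> l" by blast
      from same[OF b(4,2)] 3 consider "b = u" "b' = v" "\<tau> = s" | "b = v" "b' = u" "\<tau> = 1 - s"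
        by blast
      then have "?C (edge_point u v t) (l + \<bar>s - t\<bar>)"
      proof cases
        case 1
        then show ?thesis using b step.hyps
          by (intro exI[of _ u] exI[of _ v] exI[of _ t] exI[of _ m]) auto
      next
        case 2
        then show ?thesis using b step.hyps edge_point_flip[of u v t]
          by (intro exI[of _ v] exI[of _ u] exI[of _ "1 - t"] exI[of _ m]) auto
      qed
      then show ?thesis by blast
    qed
  qed
qed

section \<open>Attainment of the path distance\<close>

lemma metric_graph_range:
  assumes "p \<in> X"
  shows "finite (range p)" "p w \<le> 1"
proof -
  have fin: "finite (range (edge_point u v t))" for u v :: 'v and t
    by (rule finite_subset[of _ "{0, 1, t, 1 - t}"]) (auto simp: edge_point_def of_bool_def)
  show "finite (range p)"
    using assms by (cases rule: metric_graph_cases) (auto simp: fin)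
  show "p w \<le> 1"
    using assms by (cases rule: metric_graph_cases) (auto simp: edge_point_def of_bool_def)
qed

text \<open>The possible lengths of normal forms: \<open>\<bar>x - y\<bar>\<close> inside one edge,
  otherwise \<open>(1 - x) + n + (1 - y)\<close> with \<open>n\<close> whole edges between the
  initial and the final piece. Using coordinate values instead of vertices leaves finitely many
  \<open>x\<close> and \<open>y\<close>, even if vertices have infinitely many neighbours.\<close>

definition reduced_lengths :: "('v \<Rightarrow> real) \<Rightarrow> ('v \<Rightarrow> real) \<Rightarrow> real set" where
  "reduced_lengths p q = (\<Union>x\<in>range p. \<Union>y\<in>range q. insert \<bar>x - y\<bar> (range (\<lambda>n. 2 - x - y + real n)))"

lemma finite_reduced_lengths:
  assumes "p \<in> X" "q \<in> X"
  shows "finite {l \<in> reduced_lengths p q. l \<le> L}"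
proof (rule finite_subset)
  let ?S = "\<Union>x\<in>range p. \<Union>y\<in>range q. insert \<bar>x - y\<bar> ((\<lambda>n. 2 - x - y + real n) ` {..nat \<lceil>L\<rceil>})"
  show "finite ?S" using assms metric_graph_range by blast
  show "{l \<in> reduced_lengths p q. l \<le> L} \<subseteq> ?S"
  proof
    fix l assume "l \<in> {l \<in> reduced_lengths p q. l \<le> L}"
    then obtain a b where l: "l \<le> L" "l = \<bar>p a - q b\<bar> \<or> (\<exists>n. l = 2 - p a - q b + real n)"
      unfolding reduced_lengths_def by blast
    have "n \<le> nat \<lceil>L\<rceil>" if "l = 2 - p a - q b + real n" for n
      using that l(1) metric_graph_range(2)[OF assms(1), of a] metric_graph_range(2)[OF assms(2), of b]
      by linarith
    then show "l \<in> ?S" using l(2) by blast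
  qed
qed

lemma path_reduced_length:
  assumes "gpath p q l"
  shows "\<exists>l'\<le>l. gpath p q l' \<and> l' \<in> reduced_lengths p q"
proof -
  have edge: "\<bar>p a - q b\<bar> \<in> reduced_lengths p q" for a b
    unfolding reduced_lengths_def by blast
  have walk: "m + \<tau> \<in> reduced_lengths p q" if r: "reduced_to p b m" and q: "q b = 1 - \<tau>" for b m \<tau>
  proof -
    obtain a n where "m = 1 - p a + real n" using r unfolding reduced_to_def by blast
    then have "m + \<tau> = 2 - p a - q b + real n" using q by simp
    then show ?thesis unfolding reduced_lengths_def by blast
  qed
  from path_reduce[OF assms] show ?thesis
  proof (elim disjE exE conjE)
    fix u v s t
    assume uv: "(u, v) \<in> E" "s \<in> {0..1}" "t \<in> {0..1}" and p: "p = edge_point u v s"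
      and q: "q = edge_point u v t" and l: "\<bar>s - t\<bar> \<le> l"
    have "\<bar>s - t\<bar> = \<bar>p v - q v\<bar>" using p q E_neq[OF uv(1)] by (simp add: edge_point_def)
    then show ?thesis using path_edge[OF uv] p q l edge by metis
  next
    fix b m
    assume r: "reduced_to p b m" and q: "q = vertex_point b" and l: "m \<le> l"
    have "q b = 1 - 0" using q by (simp add: edge_point_def)
    from walk[OF r this] show ?thesis using r q l unfolding reduced_to_def by auto
  next
    fix b b' \<tau> m
    assume r: "reduced_to p b m" and bb: "(b, b') \<in> E" and \<tau>: "\<tau> \<in> {0..1}"
      and q: "q = edge_point b b' \<tau>" and l: "m + \<tau> \<le> l"
    have "q b = 1 - \<tau>" using q E_neq[OF bb] by (simp add: edge_point_def)
    note walk[OF r this]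
    moreover have "gpath p q (m + \<tau>)"
      using path_step[of p b b' 0 m \<tau>] r bb \<tau> q edge_point_0[of b b'] unfolding reduced_to_def by simp
    ultimately show ?thesis using l by blast
  qed
qed

text \<open>Every path can be replaced by one of reduced length that is no longer, and only finitely
  many reduced lengths are at most \<open>l\<close>, so the infimum is a minimum.\<close>

lemma path_dist:
  assumes "gpath p q l"
  shows "gpath p q (d p q)" "d p q \<le> l"
proof -
  define T where "T = {l' \<in> reduced_lengths p q. l' \<le> l \<and> gpath p q l'}"
  have "finite T"
    unfolding T_def by (rule finite_subset[OF _ finite_reduced_lengths[OF path_in[OF assms], of l]]) auto
  moreover have "T \<noteq> {}" using path_reduced_length[OF assms] unfolding T_def by blast
  ultimately have T: "Min T \<in> T" "\<And>l'. l' \<in> T \<Longrightarrow> Min T \<le> l'" by auto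
  have min: "Min T \<le> m" if m: "gpath p q m" for m
  proof (cases "m \<le> l")
    case True
    obtain m' where "m' \<le> m" "gpath p q m'" "m' \<in> reduced_lengths p q"
      using path_reduced_length[OF m] by blast
    then show ?thesis using T(2)[of m'] True unfolding T_def by auto
  next
    case False
    then show ?thesis using T(1) unfolding T_def by auto
  qed
  have "Inf {l. gpath p q l} = Min T"
    by (rule cInf_eq_minimum) (use T(1) min in \<open>auto simp: T_def\<close>)
  then have eq: "d p q = Min T" unfolding metric_graph_dist_def using assms by auto
  show "gpath p q (d p q)" "d p q \<le> l" using eq T(1) unfolding T_def by auto
qed

text \<open>Parametrization by arc length. Only an upper bound on the distances between its points
  follows; minimality of the path later makes it isometric.\<close>

lemma path_parametrization:
  assumes "gpath p q l"
  shows "\<exists>\<gamma>. \<gamma> 0 = p \<and> \<gamma> l = q \<and> (\<forall>a b. 0 \<le> a \<longrightarrow> a \<le> b \<longrightarrow> b \<le> l \<longrightarrow> gpath (\<gamma> a) (\<gamma> b) (b - a))"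
  using assms
proof (induction rule: path_induct)
  case start
  have "gpath p p (b - a)" if "0 \<le> a" "a \<le> b" "b \<le> 0" for a b :: real
  proof -
    have "b - a = 0" using that by simp
    then show ?thesis using pl_path.start[OF start] by simp
  qed
  then show ?case by (intro exI[of _ "\<lambda>_. p"]) auto
next
  case (step u v s t l)
  then obtain \<gamma> where \<gamma>: "\<gamma> 0 = p" "\<gamma> l = edge_point u v s"
    "\<And>a b. 0 \<le> a \<Longrightarrow> a \<le> b \<Longrightarrow> b \<le> l \<Longrightarrow> gpath (\<gamma> a) (\<gamma> b) (b - a)" by blast
  have l: "0 \<le> l" using path_nonneg[OF step.hyps(1)] .
  \<comment> \<open>The sign gives the direction of travel along the last piece; for
    \<open>s = t\<close> that piece has length zero.\<close>
  define pos where "pos r = s + sgn (t - s) * (r - l)" for r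
  define \<gamma>' where "\<gamma>' r = (if r \<le> l then \<gamma> r else edge_point u v (pos r))" for r
  have \<gamma>'_edge: "\<gamma>' r = edge_point u v (pos r)" if "l \<le> r" for r
    using that \<gamma>(2) unfolding \<gamma>'_def pos_def by (cases "r = l") auto
  have pos: "pos r \<in> {0..1}" if "l \<le> r" "r \<le> l + \<bar>s - t\<bar>" for r
    using that step.hyps(3-6) unfolding pos_def sgn_if by auto
  have seg: "gpath (\<gamma>' a) (\<gamma>' b) (b - a)" if "l \<le> a" "a \<le> b" "b \<le> l + \<bar>s - t\<bar>" for a b
  proof (cases "s = t")
    case True
    then have "b = a" using that by simp
    then show ?thesis
      using that pl_path.start[OF edge_point_in[OF step.hyps(2) pos[of a]]] \<gamma>'_edge[of a] by simp
  next
    case False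
    have "\<bar>pos a - pos b\<bar> = b - a" using False that unfolding pos_def sgn_if by (auto simp: algebra_simps)
    then show ?thesis
      using path_edge[OF step.hyps(2) pos[of a] pos[of b]] that \<gamma>'_edge by simp
  qed
  have "gpath (\<gamma>' a) (\<gamma>' b) (b - a)" if "0 \<le> a" "a \<le> b" "b \<le> l + \<bar>s - t\<bar>" for a b
  proof -
    consider "b \<le> l" | "a \<le> l" "l \<le> b" | "l \<le> a" by linarith
    then show ?thesis
    proof cases
      case 1
      then show ?thesis using \<gamma>(3) that unfolding \<gamma>'_def by simp
    next
      case 2
      have "gpath (\<gamma>' a) (\<gamma>' l) (l - a)" using \<gamma>(3) that(1) 2 unfolding \<gamma>'_def by simp
      from path_trans[OF seg this] show ?thesis using 2 that by simp
    next
      case 3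
      then show ?thesis using seg that by blast
    qed
  qed
  moreover have "\<gamma>' 0 = p" using \<gamma>(1) l unfolding \<gamma>'_def by simp
  moreover have "\<gamma>' (l + \<bar>s - t\<bar>) = edge_point u v t"
    using \<gamma>'_edge[of "l + \<bar>s - t\<bar>"] unfolding pos_def sgn_if by (auto split: if_splits)
  ultimately show ?case by blast
qed

end

section \<open>The geodesic metric of a connected graph\<close>

locale connected_graph = simple_graph +
  assumes connected: "u \<in> V \<Longrightarrow> v \<in> V \<Longrightarrow> \<exists>n. (u, v) \<in> E ^^ n"
begin

lemma near_vertex:
  assumes "p \<in> X"
  shows "\<exists>u\<in>V. \<exists>l\<le>1. gpath p (vertex_point u) l"
  using assms
proof (cases rule: metric_graph_cases)
  case (vertex u)
  then show ?thesis using pl_path.start[OF assms] zero_le_one by blast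
next
  case (edge u v t)
  then have "gpath p (vertex_point u) \<bar>t - 0\<bar>"
    using path_edge[of u v t 0] edge_point_0[of u v] by simp
  moreover have "\<bar>t - 0\<bar> \<le> 1" using edge by simp
  ultimately show ?thesis using E_verts(1)[OF edge(1)] by blast
qed

text \<open>This keeps the dummy value \<open>0\<close> of \<open>metric_graph_dist\<close> from
  occurring on \<open>X\<close>.\<close>

lemma ex_path:
  assumes "p \<in> X" "q \<in> X"
  shows "\<exists>l. gpath p q l"
proof -
  obtain u l where u: "u \<in> V" "gpath p (vertex_point u) l" using near_vertex[OF assms(1)] by blast
  obtain v m where v: "v \<in> V" "gpath q (vertex_point v) m" using near_vertex[OF assms(2)] by blast
  obtain n where "(u, v) \<in> E ^^ n" using connected[OF u(1) v(1)] by blast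
  from path_trans[OF path_sym[OF v(2)] path_trans[OF path_walk[OF this u(1)] u(2)]]
  show ?thesis ..
qed

lemma path_dist_in: "p \<in> X \<Longrightarrow> q \<in> X \<Longrightarrow> gpath p q (d p q)"
  using ex_path path_dist(1) by blast

lemma dist_commute: "d p q = d q p"
proof -
  have "gpath p q = gpath q p" using path_sym by (intro ext) blast
  from arg_cong[OF this, of "\<lambda>P. if \<exists>l. P l then Inf {l. P l} else 0"]
  show ?thesis unfolding metric_graph_dist_def .
qed

sublocale Metric_space X d
proof
  fix p q
  show "0 \<le> d p q"
  proof (cases "\<exists>l. gpath p q l")
    case True
    then show ?thesis using path_dist(1) path_nonneg by blast
  next
    case False
    then show ?thesis unfolding metric_graph_dist_def by (subst if_not_P) auto
  qed
  show "d p q = d q p" by (rule dist_commute)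
next
  fix p q assume X: "p \<in> X" "q \<in> X"
  show "(d p q = 0) = (p = q)"
  proof
    assume "d p q = 0"
    then have "\<bar>p w - q w\<bar> \<le> 0" for w using path_coordinate[OF path_dist_in[OF X], of w] by simp
    then show "p = q" by auto
  next
    assume "p = q"
    then have "d p q \<le> 0" "gpath p q (d p q)"
      using path_dist[OF pl_path.start[OF X(1)]] by auto
    then show "d p q = 0" using path_nonneg by fastforce
  qed
next
  fix p q r assume "p \<in> X" "q \<in> X" "r \<in> X"
  then show "d p r \<le> d p q + d q r" by (intro path_dist(2) path_trans[of q] path_dist_in)
qed

lemma geodesic_metric_graph: "geodesic_space X d"
  unfolding geodesic_space_def
proof (intro conjI ballI)
  show "Metric_space X d" by (rule Metric_space_axioms)
next
  fix p q assume X: "p \<in> X" "q \<in> X"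
  let ?L = "d p q"
  obtain \<gamma> where \<gamma>: "\<gamma> 0 = p" "\<gamma> ?L = q"
    "\<And>a b. 0 \<le> a \<Longrightarrow> a \<le> b \<Longrightarrow> b \<le> ?L \<Longrightarrow> gpath (\<gamma> a) (\<gamma> b) (b - a)"
    using path_parametrization[OF path_dist_in[OF X]] by blast
  have short: "d (\<gamma> a) (\<gamma> b) \<le> b - a" if "0 \<le> a" "a \<le> b" "b \<le> ?L" for a b
    using path_dist(2)[OF \<gamma>(3)] that by blast
  have inX: "\<gamma> a \<in> X" if "0 \<le> a" "a \<le> ?L" for a
    using path_in(1)[OF \<gamma>(3)[of a a]] that by simp
  \<comment> \<open>A shorter connection between two points of a shortest path would make the
    distance of its ends smaller than \<open>d p q\<close>.\<close>
  have iso: "d (\<gamma> a) (\<gamma> b) = b - a" if ab: "0 \<le> a" "a \<le> b" "b \<le> ?L" for a b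
  proof -
    have "d p q \<le> d p (\<gamma> a) + d (\<gamma> a) (\<gamma> b) + d (\<gamma> b) q"
      using triangle[of p "\<gamma> a" q] triangle[of "\<gamma> a" "\<gamma> b" q] X inX ab by fastforce
    moreover have "d p (\<gamma> a) \<le> a" "d (\<gamma> b) q \<le> ?L - b"
      using short[of 0 a] short[of b ?L] \<gamma> ab by auto
    ultimately show ?thesis using short[OF ab] by linarith
  qed
  have "d (\<gamma> a) (\<gamma> b) = \<bar>a - b\<bar>" if "a \<in> {0..?L}" "b \<in> {0..?L}" for a b
    using iso[of a b] iso[of b a] that commute[of "\<gamma> a" "\<gamma> b"] by (cases "a \<le> b") auto
  then show "\<exists>S. geodesic_segment X d p q S"
    unfolding geodesic_segment_def using \<gamma> inX nonneg[of p q]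
    by (intro exI[of _ "\<gamma> ` {0..?L}"] exI[of _ ?L] exI[of _ \<gamma>]) auto
qed

text \<open>A function on vertices that agrees with walk distance up to a constant suffices, because
  every point is within distance one of a vertex and the four-point inequality tolerates bounded
  errors.\<close>

lemma hyperbolic_if_four_point:
  assumes lower: "\<And>u v n. (u, v) \<in> E ^^ n \<Longrightarrow> u \<in> V \<Longrightarrow> \<rho> u v \<le> real n + K"
    and upper: "\<And>u v. u \<in> V \<Longrightarrow> v \<in> V \<Longrightarrow> \<exists>n. (u, v) \<in> E ^^ n \<and> real n \<le> \<rho> u v + K"
    and fp: "four_point \<kappa> V \<rho>"
  shows "\<exists>\<delta>>0. gromov_hyperbolic \<delta> X d"
proof -
  have "\<exists>u\<in>V. d p (vertex_point u) \<le> 1" if "p \<in> X" for p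
    using near_vertex[OF that] path_dist(2) by (meson order_trans)
  then obtain g where g: "\<And>p. p \<in> X \<Longrightarrow> g p \<in> V" "\<And>p. p \<in> X \<Longrightarrow> d p (vertex_point (g p)) \<le> 1"
    by metis
  \<comment> \<open>\<open>K\<close> is the error between vertices; each of the two moves to a
    nearby vertex costs at most one more.\<close>
  have close: "\<bar>d p q - \<rho> (g p) (g q)\<bar> \<le> K + 2" if X: "p \<in> X" "q \<in> X" for p q
  proof -
    let ?u = "vertex_point (g p)" and ?v = "vertex_point (g q)"
    have V: "?u \<in> X" "?v \<in> X" using g(1) X vertex_point_in by auto
    obtain m where m: "(g p, g q) \<in> E ^^ m" "real m \<le> d ?u ?v"
      using walk_of_path[OF connected g(1)[OF X(1)] g(1)[OF X(2)] path_dist_in[OF V]] by blast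
    obtain n where n: "(g p, g q) \<in> E ^^ n" "real n \<le> \<rho> (g p) (g q) + K"
      using upper[OF g(1)[OF X(1)] g(1)[OF X(2)]] by blast
    have "d ?u ?v \<le> real n" using path_dist(2)[OF path_walk[OF n(1) g(1)[OF X(1)]]] .
    moreover have "\<rho> (g p) (g q) \<le> real m + K" using lower[OF m(1) g(1)[OF X(1)]] .
    moreover have "d p q \<le> d p ?u + d ?u ?v + d q ?v" "d ?u ?v \<le> d p ?u + d p q + d q ?v"
      using triangle[of p ?u q] triangle[of ?u ?v q] triangle[of ?u p ?v] triangle[of p q ?v] X V
        commute[of q ?v] commute[of p ?u] by auto
    ultimately show ?thesis using g(2)[OF X(1)] g(2)[OF X(2)] m(2) n(2) by linarith
  qed
  \<comment> \<open>Four distances, two on each side of the inequality, are each replaced at a cost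
    of at most \<open>K + 2\<close>.\<close>
  define \<kappa>' where "\<kappa>' = \<kappa> + 4 * (K + 2)"
  have "four_point \<kappa>' X d"
    unfolding four_point_def
  proof (intro ballI)
    fix x y z w assume X: "x \<in> X" "y \<in> X" "z \<in> X" "w \<in> X"
    have "\<rho> (g x) (g y) + \<rho> (g z) (g w) \<le>
        max (\<rho> (g x) (g z) + \<rho> (g y) (g w)) (\<rho> (g x) (g w) + \<rho> (g y) (g z)) + \<kappa>"
      using fp g(1) X unfolding four_point_def by blast
    then show "d x y + d z w \<le> max (d x z + d y w) (d x w + d y z) + \<kappa>'"
      using close[OF X(1,2)] close[OF X(3,4)] close[OF X(1,3)] close[OF X(2,4)]
        close[OF X(1,4)] close[OF X(2,3)] unfolding \<kappa>'_def
      by (smt (verit) max_def)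
  qed
  \<comment> \<open>The absolute value and the added one make the constant positive and strictly
    larger than \<open>2 * \<kappa>'\<close>.\<close>
  then have "gromov_hyperbolic (2 * \<bar>\<kappa>'\<bar> + 1) X d"
    by (rule four_point_hyperbolic[OF geodesic_metric_graph]) linarith
  moreover have "0 < 2 * \<bar>\<kappa>'\<bar> + 1" by linarith
  ultimately show ?thesis by blast
qed

end

section \<open>The spiderweb\<close>

locale dyadic_cubes =
  fixes \<eta> c1 c2 lam :: real
    and D :: "int \<Rightarrow> 'a::metric_space set set"
    and c :: "int \<Rightarrow> 'a set \<Rightarrow> 'a"
  assumes \<eta>: "1 < \<eta>" and c1: "0 < c1" and c2: "0 < c2" and lam: "1 + c2 < lam"
    and partition: "partition_on UNIV (D k)"
    and nested: "Q \<in> D k \<Longrightarrow> k < l \<Longrightarrow> \<exists>!P. P \<in> D l \<and> Q \<subseteq> P"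
    and inner_ball: "Q \<in> D k \<Longrightarrow> ball (c k Q) (c1 * \<eta> powi k) \<subseteq> Q"
    and outer_ball: "Q \<in> D k \<Longrightarrow> Q \<subseteq> ball (c k Q) (c2 * \<eta> powi k)"
begin

abbreviation "W \<equiv> sw_verts \<eta> D c"
abbreviation "vertex \<equiv> sw_vertex \<eta> c"

section \<open>Cubes, scales and edges\<close>

lemma scale_pos: "0 < \<eta> powi k"
  using \<eta> by simp

lemma center_in: "Q \<in> D k \<Longrightarrow> c k Q \<in> Q"
  using inner_ball[of Q k] scale_pos[of k] c1 by (meson centre_in_ball mult_pos_pos subsetD)

lemma center_dist: "Q \<in> D k \<Longrightarrow> x \<in> Q \<Longrightarrow> dist (c k Q) x < c2 * \<eta> powi k"
  using outer_ball[of Q k] by auto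

lemma parent_cube: "Q \<in> D k \<Longrightarrow> parent D k Q \<in> D (k + 1) \<and> Q \<subseteq> parent D k Q"
  using theI'[OF nested[of Q k "k + 1"]] unfolding parent_def by simp

lemma scale_Suc: "\<eta> powi (k + 1) = \<eta> * \<eta> powi k"
  using \<eta> by (simp add: power_int_add)

lemma vertex_in: "Q \<in> D k \<Longrightarrow> vertex k Q \<in> W"
  unfolding sw_verts_def by blast

lemma vertexE:
  assumes "z \<in> W"
  obtains k Q where "Q \<in> D k" "z = vertex k Q"
  using assms unfolding sw_verts_def by blast

lemma vertex_pos: "z \<in> W \<Longrightarrow> 0 < snd z"
  using scale_pos by (auto simp: sw_verts_def sw_vertex_def)

sublocale simple_graph W "sw_adj lam \<eta> D c"
proof
  show "sw_adj lam \<eta> D c w z" if "sw_adj lam \<eta> D c z w" for z w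
    using that unfolding sw_adj_def by (metis Int_commute)
  show "\<not> sw_adj lam \<eta> D c z z" for z
    unfolding sw_adj_def by simp
qed

text \<open>A center lies in the parent cube, so an upward edge moves it by less than
  \<open>c2 * \<eta>\<close> times the scale of \<open>z\<close>; a horizontal edge moves it by less
  than \<open>2 * lam\<close> times that scale. The common factor \<open>2 * lam * \<eta>\<close>
  covers all cases, and only the scale of the starting vertex enters, so the bounds can be
  iterated.\<close>

lemma edge_bounds:
  assumes "(z, w) \<in> E"
  shows "snd w \<le> \<eta> * snd z" "dist (fst z) (fst w) \<le> 2 * lam * \<eta> * snd z"
proof -
  obtain k Q l R where Q: "Q \<in> D k" "R \<in> D l" "z = vertex k Q" "w = vertex l R"
    and adj: "l = k + 1 \<and> R = parent D k Q \<or> k = l + 1 \<and> Q = parent D l R \<or>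
      k = l \<and> dilated_cube lam \<eta> c k Q \<inter> dilated_cube lam \<eta> c l R \<noteq> {}"
    using assms unfolding graph_edges_def sw_adj_def by blast
  let ?r = "\<eta> powi k"
  have r: "0 < ?r" "?r \<le> \<eta> * ?r" using scale_pos[of k] \<eta> by auto
  have c2r: "c2 * ?r \<le> lam * ?r" using lam r(1) c2 by simp
  have lr: "0 < lam * ?r" "lam * ?r \<le> lam * (\<eta> * ?r)"
    using lam c2 r by (auto intro: mult_left_mono)
  have "\<eta> powi l \<le> \<eta> * ?r \<and> dist (c k Q) (c l R) \<le> 2 * (lam * (\<eta> * ?r))"
    using adj
  proof (elim disjE conjE)
    assume l: "l = k + 1" "R = parent D k Q"
    have "c k Q \<in> R" using parent_cube[OF Q(1)] center_in[OF Q(1)] l by blast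
    then have "dist (c k Q) (c l R) < \<eta> * (c2 * ?r)"
      using center_dist[OF Q(2)] scale_Suc[of k] l by (simp add: dist_commute mult.left_commute)
    also have "\<dots> \<le> \<eta> * (lam * ?r)" using c2r \<eta> by simp
    finally have "dist (c k Q) (c l R) < lam * (\<eta> * ?r)" by (simp add: mult.left_commute)
    then show ?thesis using lr l scale_Suc[of k] by simp
  next
    assume k: "k = l + 1" "Q = parent D l R"
    have "c l R \<in> Q" using parent_cube[OF Q(2)] center_in[OF Q(2)] k by blast
    then have "dist (c k Q) (c l R) < c2 * ?r" using center_dist[OF Q(1)] by blast
    moreover have "\<eta> powi l \<le> ?r" using k scale_Suc[of l] scale_pos[of l] \<eta> by simp
    ultimately show ?thesis using c2r lr r by linarith
  next
    assume k: "k = l" and "dilated_cube lam \<eta> c k Q \<inter> dilated_cube lam \<eta> c l R \<noteq> {}"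
    then obtain x where "dist (c k Q) x < lam * ?r" "dist (c l R) x < lam * ?r"
      unfolding dilated_cube_def by auto
    then have "dist (c k Q) (c l R) < 2 * (lam * ?r)"
      using dist_triangle2[of "c k Q" "c l R" x] by linarith
    then show ?thesis using lr r unfolding k[symmetric] by (intro conjI) linarith+
  qed
  then show "snd w \<le> \<eta> * snd z" "dist (fst z) (fst w) \<le> 2 * lam * \<eta> * snd z"
    unfolding Q sw_vertex_def by (simp_all add: mult.assoc)
qed

definition K :: real where "K = 2 * lam * \<eta> / (\<eta> - 1)"

lemma K_pos: "0 < K"
  unfolding K_def using \<eta> lam c2 by simp

text \<open>The constant \<open>K\<close> is chosen so that \<open>K + 2 * lam * \<eta> = K * \<eta>\<close>: the displacement of a walk is
  dominated by that of a walk which climbs at every step.\<close>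

lemma walk_bounds:
  assumes "(z, w) \<in> E ^^ n" "z \<in> W"
  shows "snd w \<le> \<eta> ^ n * snd z" "dist (fst z) (fst w) \<le> K * (\<eta> ^ n * snd z)"
proof -
  have "snd w \<le> \<eta> ^ n * snd z \<and> dist (fst z) (fst w) \<le> K * (\<eta> ^ n * snd z)"
    using assms(1)
  proof (induction n arbitrary: w)
    case 0
    then show ?case using K_pos vertex_pos[OF assms(2)] by simp
  next
    case (Suc n)
    then obtain v where v: "(z, v) \<in> E ^^ n" "(v, w) \<in> E" by auto
    note IH = Suc.IH[OF v(1)] and b = edge_bounds[OF v(2)]
    have "snd w \<le> \<eta> * (\<eta> ^ n * snd z)"
      using b(1) IH \<eta> by (meson less_le_trans mult_left_mono order_trans less_imp_le zero_less_one)
    moreover have "2 * lam * \<eta> * snd v \<le> 2 * lam * \<eta> * (\<eta> ^ n * snd z)"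
      using IH \<eta> lam c2 by (intro mult_left_mono) auto
    then have "dist (fst z) (fst w) \<le> (K + 2 * lam * \<eta>) * (\<eta> ^ n * snd z)"
      using dist_triangle[of "fst z" "fst w" "fst v"] IH b(2) by (simp add: distrib_right)
    moreover have "K + 2 * lam * \<eta> = K * \<eta>"
      unfolding K_def using \<eta> by (simp add: field_simps)
    ultimately show ?case by (simp add: mult.assoc)
  qed
  then show "snd w \<le> \<eta> ^ n * snd z" "dist (fst z) (fst w) \<le> K * (\<eta> ^ n * snd z)" by auto
qed

text \<open>\<open>log \<eta> (spread z w)\<close> approximates the height at which the ancestors of \<open>z\<close> and \<open>w\<close> become
  neighbours, and \<open>\<rho> z w\<close> the length of the walk through these ancestors.\<close>

definition spread :: "'a \<times> real \<Rightarrow> 'a \<times> real \<Rightarrow> real" where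
  "spread z w = dist (fst z) (fst w) + snd z + snd w"

definition \<rho> :: "'a \<times> real \<Rightarrow> 'a \<times> real \<Rightarrow> real" where
  "\<rho> z w = 2 * log \<eta> (spread z w) - log \<eta> (snd z) - log \<eta> (snd w)"

lemma spread_pos: "z \<in> W \<Longrightarrow> w \<in> W \<Longrightarrow> 0 < spread z w"
  unfolding spread_def using vertex_pos[of z] vertex_pos[of w] zero_le_dist[of "fst z" "fst w"]
  by linarith

lemma spread_commute: "spread z w = spread w z"
  unfolding spread_def by (simp add: dist_commute)

lemma spread_triangle: "v \<in> W \<Longrightarrow> spread z w \<le> spread z v + spread v w"
  unfolding spread_def using vertex_pos[of v] dist_triangle[of "fst z" "fst w" "fst v"] by linarith

text \<open>Each of the four vertices occurs once in every sum of two values of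
  \<open>\<rho>\<close>, so the logarithms of the scales cancel and only the product inequality for
  \<open>spread\<close> remains.\<close>

lemma four_point_\<rho>: "four_point (2 * log \<eta> 4) W \<rho>"
  unfolding four_point_def
proof (intro ballI)
  fix x y z w assume W: "x \<in> W" "y \<in> W" "z \<in> W" "w \<in> W"
  have pos: "0 < spread a b" if "a \<in> {x, y, z, w}" "b \<in> {x, y, z, w}" for a b
    using that W by (intro spread_pos) blast+
  have logs: "log \<eta> (spread x y) + log \<eta> (spread z w) \<le> log \<eta> 4 + (log \<eta> s + log \<eta> t)"
    if st: "spread x y * spread z w \<le> 4 * (s * t)" "0 < s" "0 < t" for s t
  proof -
    have "log \<eta> (spread x y * spread z w) \<le> log \<eta> (4 * (s * t))"
      using st pos[of x y] pos[of z w] \<eta> by (subst log_le_cancel_iff) auto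
    then show ?thesis using st pos[of x y] pos[of z w] by (simp add: log_mult)
  qed
  have "spread x y * spread z w \<le> 4 * max (spread x z * spread y w) (spread x w * spread y z)"
    using spread_triangle[of z x y] spread_triangle[of w x y] spread_triangle[of x z w]
      spread_triangle[of y z w] pos W
    by (intro product_four_point) (auto simp: spread_commute less_imp_le)
  then consider "spread x y * spread z w \<le> 4 * (spread x z * spread y w)"
    | "spread x y * spread z w \<le> 4 * (spread x w * spread y z)"
    by (auto simp: max_def split: if_splits)
  then show "\<rho> x y + \<rho> z w \<le> max (\<rho> x z + \<rho> y w) (\<rho> x w + \<rho> y z) + 2 * log \<eta> 4"
  proof cases
    case 1
    from logs[OF this] pos have "\<rho> x y + \<rho> z w \<le> \<rho> x z + \<rho> y w + 2 * log \<eta> 4"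
      unfolding \<rho>_def by auto
    then show ?thesis by linarith
  next
    case 2
    from logs[OF this] pos have "\<rho> x y + \<rho> z w \<le> \<rho> x w + \<rho> y z + 2 * log \<eta> 4"
      unfolding \<rho>_def by auto
    then show ?thesis by linarith
  qed
qed

lemma \<rho>_le_walk:
  assumes walk: "(z, w) \<in> E ^^ n" and z: "z \<in> W"
  shows "\<rho> z w \<le> real n + (2 * log \<eta> (2 * K + 2) + 2)"
proof -
  have w: "w \<in> W" using walk_verts[OF walk z] .
  define h where "h v = log \<eta> (snd v)" for v :: "'a \<times> real"
  have snd_powr: "snd v = \<eta> powr h v" if "v \<in> W" for v
    unfolding h_def using vertex_pos[OF that] \<eta> by simp
  have climb: "\<eta> ^ i * snd v = \<eta> powr (real i + h v)" if "v \<in> W" for v i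
    using snd_powr[OF that] \<eta> by (simp add: powr_add powr_realpow)
  \<comment> \<open>The scale bound for the walk and for its reversal shows that the end heights
    differ by at most \<open>n\<close>, whence \<open>0 \<le> r \<le> n\<close>.\<close>
  have "\<eta> powr h w \<le> \<eta> powr (real n + h z)" "\<eta> powr h z \<le> \<eta> powr (real n + h w)"
    using walk_bounds(1)[OF walk z] walk_bounds(1)[OF walk_sym[OF walk] w]
      snd_powr[OF z] snd_powr[OF w] climb[OF z] climb[OF w] by auto
  then have h: "h w \<le> real n + h z" "h z \<le> real n + h w"
    using \<eta> by auto
  \<comment> \<open>If both ends climbed at every step, they would meet at height
    \<open>M = h z + r = h w + (n - r)\<close>. Rounding \<open>r\<close> down to \<open>i\<close>
    lets the second piece exceed this by at most one, hence \<open>M + 1\<close> below.\<close>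
  define M where "M = (real n + h z + h w) / 2"
  define r where "r = (real n + h w - h z) / 2"
  define i where "i = nat \<lfloor>r\<rfloor>"
  have "0 \<le> r" "r \<le> real n" unfolding r_def using h by auto
  then have i: "real i \<le> r" "r < real i + 1" "i \<le> n"
    unfolding i_def by linarith+
  have "(z, w) \<in> E ^^ (i + (n - i))" using walk i(3) by simp
  then obtain v where v: "(z, v) \<in> E ^^ i" "(v, w) \<in> E ^^ (n - i)"
    unfolding relpow_add by blast
  have "real i + h z \<le> M + 1" "real (n - i) + h w \<le> M + 1"
    using i unfolding M_def r_def by (auto simp: of_nat_diff field_simps)
  then have le: "\<eta> ^ i * snd z \<le> \<eta> powr (M + 1)" "\<eta> ^ (n - i) * snd w \<le> \<eta> powr (M + 1)"
    using climb[OF z] climb[OF w] \<eta> by auto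
  have "dist (fst z) (fst v) \<le> K * \<eta> powr (M + 1)" "dist (fst w) (fst v) \<le> K * \<eta> powr (M + 1)"
    using walk_bounds(2)[OF v(1) z] walk_bounds(2)[OF walk_sym[OF v(2)] w] le K_pos
    by (meson less_imp_le mult_left_mono order_trans)+
  then have "dist (fst z) (fst w) \<le> 2 * K * \<eta> powr (M + 1)"
    using dist_triangle2[of "fst z" "fst w" "fst v"] by linarith
  moreover have "snd z \<le> \<eta> powr (M + 1)" "snd w \<le> \<eta> powr (M + 1)"
    unfolding snd_powr[OF z] snd_powr[OF w] M_def using h \<eta> by (auto simp: field_simps)
  ultimately have "spread z w \<le> (2 * K + 2) * \<eta> powr (M + 1)"
    unfolding spread_def distrib_right by linarith
  \<comment> \<open>In \<open>2 * K + 2\<close>, each of the two pieces contributes \<open>K\<close>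
    and each end scale contributes one. After doubling, \<open>2 * M - h z - h w = n\<close> yields
    the claim.\<close>
  then have "log \<eta> (spread z w) \<le> log \<eta> ((2 * K + 2) * \<eta> powr (M + 1))"
    using spread_pos[OF z w] \<eta> K_pos by (subst log_le_cancel_iff) auto
  also have "\<dots> = log \<eta> (2 * K + 2) + (M + 1)"
    using \<eta> K_pos by (simp add: log_mult)
  finally show ?thesis unfolding \<rho>_def h_def[symmetric] M_def by argo
qed

text \<open>The inclusion \<open>Q \<subseteq> P\<close> is kept because it puts the center of
  \<open>Q\<close> within \<open>c2\<close> times the scale of \<open>P\<close> from the center of
  \<open>P\<close>.\<close>

lemma climb:
  assumes "Q \<in> D k"
  shows "\<exists>P\<in>D (k + int n). Q \<subseteq> P \<and> (vertex k Q, vertex (k + int n) P) \<in> E ^^ n"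
proof (induction n)
  case 0
  then show ?case using assms by auto
next
  case (Suc n)
  let ?l = "k + int n"
  obtain P where P: "P \<in> D ?l" "Q \<subseteq> P" "(vertex k Q, vertex ?l P) \<in> E ^^ n" using Suc by blast
  let ?P' = "parent D ?l P"
  have P': "?P' \<in> D (?l + 1)" "P \<subseteq> ?P'" using parent_cube[OF P(1)] by auto
  \<comment> \<open>A cube and its parent may be the same set; the scales still distinguish their
    vertices.\<close>
  have "vertex ?l P \<noteq> vertex (?l + 1) ?P'"
    using scale_Suc[of ?l] scale_pos[of ?l] \<eta> unfolding sw_vertex_def by auto
  then have "(vertex ?l P, vertex (?l + 1) ?P') \<in> E"
    using P(1) P'(1) vertex_in unfolding graph_edges_def sw_adj_def by blast
  then have "(vertex k Q, vertex (?l + 1) ?P') \<in> E ^^ Suc n" using P(3) by auto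
  moreover have "k + int (Suc n) = ?l + 1" by simp
  ultimately show ?case using P(2) P' by (metis order_trans)
qed

text \<open>Climb from both vertices to a common height \<open>m\<close>, cross at most one
  horizontal edge there, and descend.\<close>

lemma walk_le_\<rho>:
  assumes z: "z \<in> W" and w: "w \<in> W"
  shows "\<exists>n. (z, w) \<in> E ^^ n \<and> real n \<le> \<rho> z w + 3"
proof -
  obtain k Q where Q: "Q \<in> D k" "z = vertex k Q" using z by (rule vertexE)
  obtain l R where R: "R \<in> D l" "w = vertex l R" using w by (rule vertexE)
  have log_scale: "log \<eta> (\<eta> powi j) = of_int j" for j
    using \<eta> by (simp flip: powr_real_of_int')
  let ?A = "spread z w"
  have A: "0 < ?A" using spread_pos[OF z w] .
  have A_ge: "\<eta> powi k < ?A" "\<eta> powi l < ?A" "dist (c k Q) (c l R) < ?A"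
    unfolding spread_def Q R sw_vertex_def
    using scale_pos[of k] scale_pos[of l] by (auto intro: add_nonneg_pos)
  \<comment> \<open>The least height whose scale is at least \<open>spread z w\<close>. The spread
    exceeds both scales, so \<open>m\<close> is not below \<open>k\<close> or
    \<open>l\<close>.\<close>
  define m where "m = \<lceil>log \<eta> ?A\<rceil>"
  have m: "log \<eta> ?A \<le> of_int m" "of_int m < log \<eta> ?A + 1"
    unfolding m_def by linarith+
  have Am: "?A \<le> \<eta> powi m"
    using m(1) A \<eta> scale_pos[of m] log_scale[of m] by (metis log_le_cancel_iff)
  have "of_int k < log \<eta> ?A" "of_int l < log \<eta> ?A"
    using A_ge A \<eta> scale_pos log_scale by (metis log_less_cancel_iff)+
  then have "k \<le> m" "l \<le> m" using m(1) by linarith+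
  then have km: "k + int (nat (m - k)) = m" and lm: "l + int (nat (m - l)) = m" by auto
  obtain P where P: "P \<in> D m" "Q \<subseteq> P" "(z, vertex m P) \<in> E ^^ nat (m - k)"
    using climb[OF Q(1), of "nat (m - k)"] unfolding km Q(2) by blast
  obtain S where S: "S \<in> D m" "R \<subseteq> S" "(w, vertex m S) \<in> E ^^ nat (m - l)"
    using climb[OF R(1), of "nat (m - l)"] unfolding lm R(2) by blast
  have "\<exists>j\<le>1. (vertex m P, vertex m S) \<in> E ^^ j"
  proof (cases "P = S")
    case True
    then show ?thesis by (intro exI[of _ 0]) auto
  next
    case False
    have "P \<inter> S = {}"
      using partition[of m] P(1) S(1) False unfolding partition_on_def disjoint_def by blast
    \<comment> \<open>Adjacency requires distinct vertices; disjoint cubes have distinct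
      centers.\<close>
    then have ne: "vertex m P \<noteq> vertex m S"
      using center_in[OF P(1)] center_in[OF S(1)] unfolding sw_vertex_def by auto
    have r: "0 < \<eta> powi m" by (rule scale_pos)
    have lamr: "c2 * \<eta> powi m + \<eta> powi m < lam * \<eta> powi m"
      using mult_strict_right_mono[OF lam r] by (simp add: distrib_right)
    have "dist (c m P) (c k Q) < c2 * \<eta> powi m"
      using center_dist[OF P(1)] center_in[OF Q(1)] P(2) by blast
    then have "c k Q \<in> dilated_cube lam \<eta> c m P"
      unfolding dilated_cube_def using lamr r by auto
    moreover have "dist (c m S) (c l R) < c2 * \<eta> powi m"
      using center_dist[OF S(1)] center_in[OF R(1)] S(2) by blast
    \<comment> \<open>The center of \<open>Q\<close> witnesses that the dilated cubes meet: it is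
      less than \<open>?A \<le> \<eta> powi m\<close> away from \<open>c l R\<close>, which is less
      than \<open>c2 * \<eta> powi m\<close> away from \<open>c m S\<close>. The bound
      \<open>1 + c2 < lam\<close> absorbs the sum.\<close>
    then have "c k Q \<in> dilated_cube lam \<eta> c m S"
      unfolding dilated_cube_def mem_ball
      using lamr A_ge(3) Am dist_triangle[of "c m S" "c k Q" "c l R"] dist_commute[of "c l R" "c k Q"]
      by linarith
    ultimately have "(vertex m P, vertex m S) \<in> E"
      using P(1) S(1) vertex_in ne False unfolding graph_edges_def sw_adj_def by blast
    then show ?thesis by (intro exI[of _ 1]) auto
  qed
  then obtain j where j: "j \<le> 1" "(vertex m P, vertex m S) \<in> E ^^ j" by blast
  let ?n = "nat (m - k) + j + nat (m - l)"
  have "(z, w) \<in> E ^^ ?n"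
    using P(3) j(2) walk_sym[OF S(3)] unfolding relpow_add by blast
  moreover have "\<rho> z w = 2 * log \<eta> ?A - k - l"
    unfolding \<rho>_def Q R by (simp add: sw_vertex_def log_scale)
  \<comment> \<open>Rounding up to \<open>m\<close> costs at most one on each of the two climbs, and
    the horizontal edge one more.\<close>
  then have "real ?n \<le> \<rho> z w + 3"
    using m(2) j(1) \<open>k \<le> m\<close> \<open>l \<le> m\<close> by simp
  ultimately show ?thesis by blast
qed

text \<open>Connectedness comes with the upper bound, which already provides a walk between any two
  vertices.\<close>

sublocale connected_graph W "sw_adj lam \<eta> D c"
  by unfold_locales (use walk_le_\<rho> in blast)

lemma hyperbolic_spiderweb:
  "\<exists>\<delta>>0. gromov_hyperbolic \<delta> (spiderweb lam \<eta> D c) (spiderweb_dist lam \<eta> D c)"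
  unfolding spiderweb_def spiderweb_dist_def
proof (rule hyperbolic_if_four_point[OF _ _ four_point_\<rho>])
  let ?C = "max (2 * log \<eta> (2 * K + 2) + 2) 3"
  show "\<rho> u v \<le> real n + ?C" if "(u, v) \<in> E ^^ n" "u \<in> W" for u v n
    using \<rho>_le_walk[OF that] by linarith
  show "\<exists>n. (u, v) \<in> E ^^ n \<and> real n \<le> \<rho> u v + ?C" if "u \<in> W" "v \<in> W" for u v
    using walk_le_\<rho>[OF that] by (meson add_left_mono max.cobounded2 order_trans)
qed

end

theorem proposition3p14:
  fixes \<mu> :: "'a::metric_space measure"
    and \<eta> c1 c2 lam :: real
    and D :: "int \<Rightarrow> 'a set set"
    and c :: "int \<Rightarrow> 'a set \<Rightarrow> 'a"
  assumes "geodesic_space (UNIV :: 'a set) dist"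
    and "doubling_measure \<mu>"
    and "dyadic_system \<mu> \<eta> c1 c2 D c"
    and "lam > max (\<eta> / (\<eta> - 1) * c2) (2 * c2 + 1)"
  shows "\<exists>\<delta>>0. gromov_hyperbolic \<delta> (spiderweb lam \<eta> D c) (spiderweb_dist lam \<eta> D c)"
proof -
  have "dyadic_cubes \<eta> c1 c2 lam D c"
    \<comment> \<open>The locale's \<open>1 + c2 < lam\<close> follows from
      \<open>2 * c2 + 1 < lam\<close> and \<open>0 < c2\<close>.\<close>
    using assms(3,4) unfolding dyadic_system_def by unfold_locales auto
  then show ?thesis by (rule dyadic_cubes.hyperbolic_spiderweb)
qed

end
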